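(* Let $q\in L^\infty(\mathbb{R}^2)$ be compactly supported in a bounded set $D\subset\mathbb{R}^2$, let $k>0$ and $C_k\in\mathbb{C}\setminus\{0\}$, and let the far field be given by its Born approximation $$u^\infty(\theta,\varphi;k)=C_k\int_D q(y)\,e^{-\mathrm{i}k(\hat x(\theta)-d(\varphi))\cdot y}\,\mathrm{d}y,\qquad \hat x(\theta)=(\cos\theta,\sin\theta),\quad d(\varphi)=(\cos\varphi,\sin\varphi).$$ Then for all $m,n\in\mathbb{Z}$ the two-angle Fourier coefficients $a_{mn}(k)$ satisfy $$a_{mn}(k)=C_k(-\mathrm{i})^m\mathrm{i}^n\int_D q(r,\psi)\,J_m(kr)\,J_n(kr)\,e^{-\mathrm{i}(m+n)\psi}\,r\,\mathrm{d}r\,\mathrm{d}\psi.$$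
   Context: The two-angle Fourier coefficients of the far field are $$a_{mn}(k)=\frac{1}{(2\pi)^2}\int_0^{2\pi}\int_0^{2\pi}u^\infty(\theta,\varphi;k)\,e^{-\mathrm{i}m\theta}e^{-\mathrm{i}n\varphi}\,\mathrm{d}\theta\,\mathrm{d}\varphi .$$ $J_m$ is the Bessel function of the first kind of integer order $m$. $q(r,\psi)$ denotes $q$ written in polar coordinates $y=r(\cos\psi,\sin\psi)$, and the last integral is over $D$ in polar coordinates. *)

theory Defs
  imports "HOL-Analysis.Analysis"
begin

text \<open>
  Elements of $L^\infty(\mathbb{R}^2)$ are given by complex-valued, Lebesgue measurable
  representatives; the two notions below do not depend on the choice of the representative.
\<close>

definition ess_bounded :: "(real^2 \<Rightarrow> complex) \<Rightarrow> bool" where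
  "ess_bounded q \<longleftrightarrow>
     q \<in> borel_measurable lebesgue \<and> (\<exists>B. AE y in lebesgue. norm (q y) \<le> B)"

text \<open>The support in the sense of $L^\infty$: the complement of the largest open set on which
  the function vanishes almost everywhere.\<close>

definition ess_support :: "(real^2 \<Rightarrow> complex) \<Rightarrow> (real^2) set" where
  "ess_support q = - \<Union> {U. open U \<and> (AE y in lebesgue. y \<in> U \<longrightarrow> q y = 0)}"

text \<open>For integers \<open>m < 0\<close> the terms with \<open>j + m < 0\<close> vanish because the reciprocal Gamma
  function is zero at the nonpositive integers; in particular no term with a negative power
  of \<open>x / 2\<close> contributes.\<close>

definition bessel_J :: "int \<Rightarrow> real \<Rightarrow> real" where
  "bessel_J m x =
     (\<Sum>j. (-1) ^ j * rGamma (of_int (int j + m + 1)) / fact j * (x / 2) powi (2 * int j + m))"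

definition dir :: "real \<Rightarrow> real^2" where
  "dir \<theta> = vector [cos \<theta>, sin \<theta>]"

definition born_far_field ::
    "complex \<Rightarrow> (real^2 \<Rightarrow> complex) \<Rightarrow> (real^2) set \<Rightarrow> real \<Rightarrow> real \<Rightarrow> real \<Rightarrow> complex" where
  "born_far_field C q D k \<theta> \<phi> =
     C * (LINT y:D|lebesgue. q y * exp (- \<i> * of_real (k * ((dir \<theta> - dir \<phi>) \<bullet> y))))"

definition two_angle_coeff :: "(real \<Rightarrow> real \<Rightarrow> complex) \<Rightarrow> int \<Rightarrow> int \<Rightarrow> complex" where
  "two_angle_coeff u m n =
     1 / (2 * of_real pi)\<^sup>2 *
     (LINT \<phi>:{0..2 * pi}|lebesgue. LINT \<theta>:{0..2 * pi}|lebesgue.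
        u \<theta> \<phi> * exp (- \<i> * of_int m * of_real \<theta>) * exp (- \<i> * of_int n * of_real \<phi>))"

definition polar_region :: "(real^2) set \<Rightarrow> (real \<times> real) set" where
  "polar_region D = {(r, \<psi>). 0 \<le> r \<and> 0 \<le> \<psi> \<and> \<psi> < 2 * pi \<and> r *\<^sub>R dir \<psi> \<in> D}"

end

theory Submission
  imports Defs
begin

text \<open>
  The Born far field is the integral of \<open>q\<close> against the product of two plane waves, one depending on
  the observation angle \<open>\<theta>\<close> only and the other on the incidence angle \<open>\<phi>\<close> only. By Fubini's theorem
  (\<open>integral_Icc_swap\<close>, used once per angle) its two-angle Fourier coefficient is therefore the
  integral of \<open>q\<close> against the product of two one-angle Fourier coefficients of plane waves. At the
  point with polar coordinates \<open>(r, \<psi>)\<close> the phases are \<open>- k * r * cos (\<theta> - \<psi>)\<close> and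
  \<open>k * r * cos (\<phi> - \<psi>)\<close>, and by the Jacobi--Anger expansion (\<open>integral_exp_cos_coeff\<close>) the
  coefficients are \<open>(- \<i>) powi m * bessel_J m (k * r)\<close> and \<open>\<i> powi n * bessel_J n (k * r)\<close>, up to
  the phases \<open>cis (- m * \<psi>)\<close> and \<open>cis (- n * \<psi>)\<close>. Passing to polar coordinates
  (\<open>lborel_polar\<close>) yields the formula.

  Jacobi--Anger is obtained by expanding exponential series on the unit circle and integrating term
  by term. The polar coordinate formula is derived from the change of variables theorem by comparing
  measures of boxes.

  The function \<open>q\<close> is only Lebesgue measurable and \<open>D\<close> may be non-measurable. Both are dealt
  with at once in \<open>ess_bounded_borel_representative\<close>: the restriction of \<open>q\<close> to \<open>D\<close> agrees almost
  everywhere with an integrable Borel function \<open>Q\<close>, since \<open>q\<close> vanishes almost everywhere off its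
  compact essential support. The same exceptional null set stays null in polar coordinates
  (\<open>AE_polar\<close>), so that both sides of the theorem can be computed with \<open>Q\<close>.
\<close>

section \<open>The Jacobi--Anger expansion\<close>

text \<open>Termwise integration of the exponential series. The \<open>j\<close>-th term is bounded by
  \<open>norm c ^ j / fact j * norm (g x)\<close>, which is summable in \<open>j\<close> uniformly up to the integrable factor.\<close>

lemma exp_series_integral:
  fixes e g :: "'a \<Rightarrow> complex"
  assumes g: "integrable M g" and e: "e \<in> borel_measurable M" and le: "\<And>x. norm (e x) \<le> 1"
  shows "(\<lambda>j. c ^ j / fact j * (\<integral>x. e x ^ j * g x \<partial>M)) sums (\<integral>x. exp (c * e x) * g x \<partial>M)"
proof -
  note [measurable] = e borel_measurable_integrable[OF g]
  define f where "f j x = (c ^ j / fact j) * (e x ^ j * g x)" for j x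
  have int: "integrable M (\<lambda>x. e x ^ j * g x)" for j
    by (rule Bochner_Integration.integrable_bound[OF g])
       (auto simp: norm_mult norm_power intro!: mult_left_le_one_le power_le_one le)
  then have intf: "integrable M (f j)" for j
    unfolding f_def by auto
  have nf: "norm (f j x) \<le> norm c ^ j / fact j * norm (g x)" for j x
  proof -
    have "norm (e x) ^ j * norm (g x) \<le> norm (g x)"
      by (simp add: mult_left_le_one_le power_le_one le)
    then have "norm c ^ j / fact j * (norm (e x) ^ j * norm (g x)) \<le> norm c ^ j / fact j * norm (g x)"
      by (rule mult_left_mono) simp
    then show ?thesis
      by (simp add: f_def norm_mult norm_power norm_divide)
  qed
  have sm: "summable (\<lambda>j. norm c ^ j / fact j)"
    using summable_exp[of "norm c"] by (simp add: field_simps)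
  have fs: "(\<lambda>j. f j x) sums (exp (c * e x) * g x)" for x
    using sums_mult2[OF exp_converges[of "c * e x"], of "g x"]
    by (simp add: f_def scaleR_conv_of_real power_mult_distrib field_simps)
  have "(\<lambda>j. integral\<^sup>L M (f j)) sums (\<integral>x. (\<Sum>j. f j x) \<partial>M)"
  proof (rule sums_integral)
    show "AE x in M. summable (\<lambda>j. norm (f j x))"
    proof (rule AE_I2)
      fix x show "summable (\<lambda>j. norm (f j x))"
        by (rule summable_comparison_test'[OF summable_mult2[OF sm, of "norm (g x)"], of 0])
           (use nf in auto)
    qed
    show "summable (\<lambda>j. \<integral>x. norm (f j x) \<partial>M)"
    proof (rule summable_comparison_test'[OF summable_mult2[OF sm, of "\<integral>x. norm (g x) \<partial>M"], of 0])
      fix j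
      have "(\<integral>x. norm (f j x) \<partial>M) \<le> (\<integral>x. norm c ^ j / fact j * norm (g x) \<partial>M)"
        by (intro integral_mono integrable_norm intf integrable_mult_right g nf)
      then show "norm (\<integral>x. norm (f j x) \<partial>M) \<le> norm c ^ j / fact j * (\<integral>x. norm (g x) \<partial>M)"
        by simp
    qed
  qed (rule intf)
  moreover have "(\<Sum>j. f j x) = exp (c * e x) * g x" for x
    using fs by (simp add: sums_iff)
  moreover have "integral\<^sup>L M (f j) = c ^ j / fact j * (\<integral>x. e x ^ j * g x \<partial>M)" for j
    unfolding f_def by (rule integral_mult_right_zero)
  ultimately show ?thesis
    by simp
qed

lemma integral_circle_mode:
  fixes p :: int
  shows "(LINT t:{0..2*pi}|lborel. cis (of_int p * t)) = (if p = 0 then 2 * of_real pi else 0)"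
proof (cases "p = 0")
  case True
  then show ?thesis
    by (simp add: set_lebesgue_integral_def scaleR_conv_of_real)
next
  case False
  define F where "F t = cis (of_int p * t) / (\<i> * of_int p)" for t :: real
  have "(\<integral>t. indicator {0..2*pi} t *\<^sub>R cis (of_int p * t) \<partial>lborel) = F (2*pi) - F 0"
  proof (rule integral_FTC_Icc)
    show "(F has_vector_derivative cis (of_int p * t)) (at t within {0..2*pi})" for t
    proof -
      have "((\<lambda>t. exp (\<i> * of_int p * t) / (\<i> * of_int p)) has_field_derivative exp (\<i> * of_int p * of_real t))
          (at (of_real t))"
        using False by (auto intro!: derivative_eq_intros)
      then show ?thesis
        unfolding F_def cis_conv_exp
        by (auto dest!: has_vector_derivative_real_field intro: has_vector_derivative_at_within simp: mult.assoc)
    qed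
  qed (auto intro!: continuous_intros)
  also have "F (2*pi) = F 0"
  proof -
    have "of_int p * (2 * pi) = 2 * pi * of_int p" by simp
    then have "cis (of_int p * (2 * pi)) = 1"
      by (metis Ints_of_int cis_multiple_2pi)
    then show ?thesis
      unfolding F_def by simp
  qed
  finally show ?thesis
    using False by (simp add: set_lebesgue_integral_def)
qed

lemma borel_measurable_cis [measurable]: "cis \<in> borel_measurable borel"
  by (intro borel_measurable_continuous_onI continuous_intros)

text \<open>The reciprocal Gamma function gives one formula for inverse factorials that also returns
  \<open>0\<close> at negative integers, so Fourier coefficients of either sign of the index take the form that occurs in
  the series of \<open>bessel_J\<close>.\<close>

lemma rGamma_int_plus_one:
  "rGamma (of_int p + 1 :: 'a :: Gamma) = (if 0 \<le> p then 1 / fact (nat p) else 0)"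
proof (cases "0 \<le> p")
  case True
  then obtain n where n: "p = int n" by (metis nonneg_int_cases)
  then show ?thesis
    using Gamma_fact[of n, where ?'a='a] by (simp add: rGamma_inverse_Gamma add.commute divide_inverse)
next
  case False
  have "of_int p + 1 \<in> (\<int>\<^sub>\<le>\<^sub>0 :: 'a set)"
    using False by (metis add.commute nonpos_Ints_of_int of_int_1 of_int_add zless_add1_eq not_le add_le_cancel_left linorder_not_less int_one_le_iff_zero_less zle_add1_eq_le)
  then show ?thesis
    using False by (simp add: rGamma_eq_zero_iff)
qed

text \<open>The Fourier coefficients of \<open>exp (a * z)\<close> on the unit circle are its Taylor coefficients:
  orthogonality of the modes leaves only the term with \<open>j = p\<close>, and none for negative \<open>p\<close>.\<close>

lemma integral_exp_circle_coeff:
  fixes p :: int and a :: complex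
  shows "(LINT t:{0..2*pi}|lborel. exp (a * cis t) * cis (- (of_int p * t)))
    = 2 * of_real pi * rGamma (of_int p + 1) * a powi p"
proof -
  define g where "g t = indicator {0..2*pi} t *\<^sub>R cis (- (of_int p * t))" for t :: real
  have g: "integrable lborel g"
    unfolding g_def by (rule borel_integrable_compact) (auto intro!: continuous_intros)
  have coeff: "(\<integral>t. cis t ^ j * g t \<partial>lborel) = (if int j = p then 2 * of_real pi else 0)" for j
  proof -
    have "cis t ^ j * g t = indicator {0..2*pi} t *\<^sub>R cis (of_int (int j - p) * t)" for t
      by (simp add: g_def Complex.DeMoivre cis_mult left_diff_distrib)
    then show ?thesis
      using integral_circle_mode[of "int j - p"] by (simp add: set_lebesgue_integral_def)
  qed
  have sums: "(\<lambda>j. a ^ j / fact j * (if int j = p then 2 * of_real pi else 0)) sums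
     (\<integral>t. exp (a * cis t) * g t \<partial>lborel)"
    using exp_series_integral[OF g, of cis a] by (simp add: coeff)
  have "(\<lambda>j. a ^ j / fact j * (if int j = p then 2 * of_real pi else 0)) sums
     (2 * of_real pi * rGamma (of_int p + 1) * a powi p)"
  proof (cases "0 \<le> p")
    case True
    then have "(\<lambda>j. a ^ j / fact j * (if int j = p then 2 * of_real pi else 0)) =
        (\<lambda>j. if j = nat p then 2 * of_real pi * rGamma (of_int p + 1) * a powi p else 0)"
      by (auto simp: fun_eq_iff rGamma_int_plus_one power_int_def)
    then show ?thesis
      using sums_single[of "nat p" "\<lambda>_. 2 * of_real pi * rGamma (of_int p + 1) * a powi p"] by simp
  next
    case False
    then have "(\<lambda>j. a ^ j / fact j * (if int j = p then 2 * of_real pi else 0)) = (\<lambda>j. 0)"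
      by (auto simp: fun_eq_iff)
    with False show ?thesis
      by (simp add: rGamma_int_plus_one)
  qed
  with sums have "(\<integral>t. exp (a * cis t) * g t \<partial>lborel) = 2 * of_real pi * rGamma (of_int p + 1) * a powi p"
    by (rule sums_unique2)
  then show ?thesis
    by (simp add: set_lebesgue_integral_def g_def)
qed

text \<open>Jacobi--Anger expansion, as a formula for the Fourier coefficients of a plane wave on a circle.
  With \<open>w = \<sigma> * x / 2\<close> one has
  \<open>exp (\<sigma> * x * cos (t - \<psi>)) = exp (b * cis (- t)) * exp (a * cis t)\<close>
  for \<open>a = w * cis (- \<psi>)\<close> and \<open>b = w * cis \<psi>\<close>. Expanding only the first factor leaves in the
  \<open>j\<close>-th term the Fourier coefficient of index \<open>j + m\<close> of the second factor, which is a Taylor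
  coefficient. The resulting series in \<open>j\<close> is the defining series of \<open>bessel_J m x\<close> term by term:
  \<open>\<sigma> powi (2 * int j + m) = (- 1) ^ j * \<sigma> powi m\<close>, and the phases of \<open>a\<close> and \<open>b\<close> combine to
  \<open>cis (- (of_int m * \<psi>))\<close>. As \<open>x\<close> is positive, \<open>w\<close> is nonzero
  and exponents of its integer powers add up, negative ones included.\<close>

lemma integral_exp_cos_coeff:
  fixes \<sigma> :: complex and m :: int
  assumes \<sigma>: "\<sigma>\<^sup>2 = -1" and x: "x > 0"
  shows "(LINT t:{0..2*pi}|lborel. exp (\<sigma> * of_real (x * cos (t - \<psi>))) * cis (- (of_int m * t)))
    = 2 * of_real pi * \<sigma> powi m * of_real (bessel_J m x) * cis (- (of_int m * \<psi>))"
    (is "?I = _")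
proof -
  define w where "w = \<sigma> * of_real (x / 2)"
  define a where "a = w * cis (- \<psi>)"
  define b where "b = w * cis \<psi>"
  define g where "g t = indicator {0..2*pi} t *\<^sub>R (exp (a * cis t) * cis (- (of_int m * t)))" for t :: real
  define T where "T j = (-1) ^ j * rGamma (of_int (int j + m + 1)) / fact j * (x / 2) powi (2 * int j + m)" for j
  define K where "K = 2 * of_real pi * \<sigma> powi m * cis (- (of_int m * \<psi>))"
  have \<sigma>0: "\<sigma> \<noteq> 0" using \<sigma> by auto
  then have K0: "K \<noteq> 0" by (simp add: K_def)
  from \<sigma>0 have w0: "w \<noteq> 0" using x by (simp add: w_def)
  have g: "integrable lborel g"
    unfolding g_def by (rule borel_integrable_compact) (auto intro!: continuous_intros)
  have "exp (\<sigma> * of_real (x * cos (t - \<psi>))) = exp (b * cis (- t)) * exp (a * cis t)" for t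
  proof -
    have c: "of_real (cos (t - \<psi>)) = (cis (t - \<psi>) + cis (\<psi> - t)) / 2"
      by (simp add: complex_eq_iff cos_diff sin_diff mult.commute)
    have "b * cis (- t) = w * cis (\<psi> - t)" "a * cis t = w * cis (t - \<psi>)"
      by (simp_all add: a_def b_def mult.assoc cis_mult)
    then have "\<sigma> * of_real (x * cos (t - \<psi>)) = b * cis (- t) + a * cis t"
      unfolding of_real_mult c by (simp add: w_def field_simps)
    then show ?thesis
      by (simp only: exp_add)
  qed
  then have I: "?I = (\<integral>t. exp (b * cis (- t)) * g t \<partial>lborel)"
    by (simp add: set_lebesgue_integral_def g_def mult_ac)
  have coeff: "(\<integral>t. cis (- t) ^ j * g t \<partial>lborel)
      = 2 * of_real pi * rGamma (of_int (int j + m) + 1) * a powi (int j + m)" for j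
  proof -
    have "cis (- t) ^ j * g t = indicator {0..2*pi} t *\<^sub>R
       (exp (a * cis t) * cis (- (of_int (int j + m) * t)))" for t
      by (simp add: g_def Complex.DeMoivre cis_mult mult.left_commute)
         (auto simp: algebra_simps intro!: arg_cong[of _ _ cis])
    then show ?thesis
      using integral_exp_circle_coeff[of a "int j + m"] by (simp add: set_lebesgue_integral_def)
  qed
  have "(\<lambda>j. b ^ j / fact j * (2 * of_real pi * rGamma (of_int (int j + m) + 1) * a powi (int j + m))) sums ?I"
    using exp_series_integral[OF g, of "\<lambda>t. cis (- t)" b] by (simp only: coeff I) simp
  moreover have "b ^ j / fact j * (2 * of_real pi * rGamma (of_int (int j + m) + 1) * a powi (int j + m))
     = (2 * of_real pi * \<sigma> powi m * cis (- (of_int m * \<psi>))) * of_real (T j)" for j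
  proof -
    have "b ^ j * a powi (int j + m) = w powi (2 * int j + m) * (cis \<psi> ^ j * cis (- \<psi>) powi (int j + m))"
    proof -
      have "w powi (2 * int j + m) = w ^ j * w ^ j * w powi m"
        using w0 by (simp add: power_int_add power_int_mult power2_eq_square power_mult_distrib)
      moreover have "a powi (int j + m) = w ^ j * w powi m * cis (- \<psi>) powi (int j + m)"
        using w0 by (simp add: a_def power_int_mult_distrib power_int_add)
      ultimately show ?thesis
        by (simp add: b_def power_mult_distrib)
    qed
    also have "cis \<psi> ^ j * cis (- \<psi>) powi (int j + m) = cis (- (of_int m * \<psi>))"
      by (simp add: Complex.DeMoivre cis_power_int cis_mult algebra_simps)
    also have "w powi (2 * int j + m) = (-1) ^ j * \<sigma> powi m * of_real ((x / 2) powi (2 * int j + m))"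
    proof -
      have "\<sigma> powi (2 * int j + m) = (-1) ^ j * \<sigma> powi m"
        using \<sigma>0 \<sigma> by (simp add: power_int_add power_int_mult)
      then show ?thesis
        unfolding w_def power_int_mult_distrib of_real_power_int by simp
    qed
    finally have "b ^ j * a powi (int j + m) = (-1) ^ j * \<sigma> powi m * of_real ((x / 2) powi (2 * int j + m)) * cis (- (of_int m * \<psi>))" .
    moreover have "rGamma (of_int (int j + m) + 1) = (of_real (rGamma (of_int (int j + m + 1))) :: complex)"
      unfolding of_int_add[of _ 1] of_int_1 rGamma_int_plus_one by simp
    ultimately show ?thesis
      unfolding T_def by (simp add: field_simps)
  qed
  ultimately have "(\<lambda>j. K * of_real (T j)) sums ?I"
    by (simp add: K_def)
  \<comment> \<open>The Bessel series is real and \<open>suminf\<close> says nothing about convergence, so convergence is first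
    read off from the complex series, whose limit then is identified.\<close>
  then have *: "(\<lambda>j. of_real (T j)) sums (?I / K)"
    using sums_divide[of "\<lambda>j. K * of_real (T j)" ?I K] K0 by simp
  then have "T sums Re (?I / K)"
    using sums_Re by fastforce
  then have "T sums bessel_J m x"
    unfolding bessel_J_def T_def[symmetric] by (simp add: sums_iff)
  then have "(\<lambda>j. of_real (T j)) sums (of_real (bessel_J m x) :: complex)"
    by (rule sums_of_real)
  with * have "?I / K = of_real (bessel_J m x)"
    by (rule sums_unique2)
  then show ?thesis
    using K0 by (simp add: K_def field_simps)
qed

section \<open>Polar coordinates\<close>

definition polar_map :: "real \<times> real \<Rightarrow> real^2" where
  "polar_map p = fst p *\<^sub>R dir (snd p)"

text \<open>The radius \<open>0\<close> and the angle \<open>2 * pi\<close> are excluded to make \<open>polar_map\<close> injective.\<close>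

definition polar_domain :: "(real \<times> real) set" where
  "polar_domain = {0<..} \<times> {0..<2 * pi}"

lemma dir_nth [simp]: "dir t $ 1 = cos t" "dir t $ 2 = sin t"
  by (simp_all add: dir_def)

lemma continuous_on_dir [continuous_intros]:
  fixes f :: "'a::t2_space \<Rightarrow> real"
  shows "continuous_on S f \<Longrightarrow> continuous_on S (\<lambda>x. dir (f x))"
proof -
  assume f: "continuous_on S f"
  have "dir t = (\<chi> i. if i = 1 then cos t else sin t)" for t
    by (simp add: vec_eq_iff forall_2)
  moreover have "continuous_on S (\<lambda>x. if i = 1 then cos (f x) else sin (f x))" for i :: 2
    using f by (cases "i = 1") (auto intro!: continuous_on_cos continuous_on_sin)
  ultimately show ?thesis
    by (simp add: continuous_on_vec_lambda)
qed

lemma borel_measurable_dir [measurable]: "dir \<in> borel_measurable borel"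
  by (intro borel_measurable_continuous_onI continuous_intros)

lemma borel_measurable_polar_map [measurable]: "polar_map \<in> borel_measurable borel"
  unfolding polar_map_def by (intro borel_measurable_continuous_onI continuous_intros)

lemma polar_domain_borel [measurable]: "polar_domain \<in> sets borel"
  unfolding polar_domain_def by (intro borel_Times) auto

lemma borel_measurable_vec2 [measurable]: "(\<lambda>p. vector [fst p, snd p] :: real^2) \<in> borel_measurable borel"
proof -
  have "continuous_on UNIV (\<lambda>p. vector [fst p, snd p] :: real^2)"
    unfolding continuous_on_componentwise[of _ "\<lambda>p. vector [fst p, snd p] :: real^2"]
    by (auto simp: Basis_vec_def inner_axis forall_2 intro!: continuous_intros)
  then show ?thesis by (rule borel_measurable_continuous_onI)
qed

text \<open>The change of variables theorem speaks about \<open>real^2\<close>, while polar parameters are pairs; this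
  identifies the two copies of the plane as measure spaces.\<close>

lemma lborel_vec2:
  "distr (lborel :: (real \<times> real) measure) borel (\<lambda>p. vector [fst p, snd p]) = (lborel :: (real^2) measure)"
proof (rule lborel_eqI[symmetric])
  fix l u :: "real^2" assume lu: "\<And>b. b \<in> Basis \<Longrightarrow> l \<bullet> b \<le> u \<bullet> b"
  have "l $ i \<le> u $ i" for i
    using lu[of "axis i 1"] by (simp add: inner_axis)
  then have le: "l $ 1 \<le> u $ 1" "l $ 2 \<le> u $ 2" by auto
  have B: "(Basis :: (real^2) set) = {axis 1 1, axis 2 1}"
    by (auto simp: Basis_vec_def) (metis exhaust_2)
  have ne: "axis 1 1 \<noteq> (axis 2 1 :: real^2)"
    by (simp add: axis_eq_axis)
  have "(\<lambda>p. vector [fst p, snd p]) -` box l u = box (l$1, l$2) (u$1, u$2)"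
    by (auto simp: box_def B inner_axis Basis_prod_def)
  then have "emeasure (distr lborel borel (\<lambda>p. vector [fst p, snd p])) (box l u)
     = emeasure lborel (box (l$1, l$2) (u$1, u$2))"
    by (subst emeasure_distr) auto
  also have "\<dots> = (\<Prod>b\<in>Basis. (u - l) \<bullet> b)"
  proof -
    have "(\<Prod>b\<in>Basis. ((u$1, u$2) - (l$1, l$2)) \<bullet> b) = (u$1 - l$1) * (u$2 - l$2)"
      by (simp add: Basis_prod_def)
    moreover have "(\<Prod>b\<in>Basis. (u - l) \<bullet> b) = (u$1 - l$1) * (u$2 - l$2)"
      using ne by (simp add: B inner_axis)
    moreover have "(l $ 1, l $ 2) \<bullet> b \<le> (u $ 1, u $ 2) \<bullet> b" if "b \<in> Basis" for b
      using that le by (auto simp: Basis_prod_def)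
    ultimately show ?thesis
      by (subst emeasure_lborel_box) auto
  qed
  finally show "emeasure (distr lborel borel (\<lambda>p. vector [fst p, snd p])) (box l u) = (\<Prod>b\<in>Basis. (u - l) \<bullet> b)" .
qed simp

lemma inj_on_polar: "inj_on polar_map polar_domain"
proof (rule inj_onI, unfold polar_domain_def polar_map_def, clarsimp)
  fix r s :: real and a b :: real
  assume A: "0 < r" "0 < s" "0 \<le> a" "a < 2*pi" "0 \<le> b" "b < 2*pi" and e: "r *\<^sub>R dir a = s *\<^sub>R dir b"
  have 1: "r * cos a = s * cos b" "r * sin a = s * sin b"
    using arg_cong[OF e, of "\<lambda>v. v $ 1"] arg_cong[OF e, of "\<lambda>v. v $ 2"] by auto
  have "r\<^sup>2 = (r * cos a)\<^sup>2 + (r * sin a)\<^sup>2"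
    by (simp add: power_mult_distrib flip: distrib_left)
  also have "\<dots> = s\<^sup>2"
    unfolding 1 by (simp add: power_mult_distrib flip: distrib_left)
  finally have rs: "r = s" using A by simp
  then have "sin a = sin b \<and> cos a = cos b"
    using 1 A by auto
  then have "cis a = cis b"
    by (simp add: complex_eq_iff)
  then have "a = b"
    using A Arg2pi_unique[of 1 a "cis b"] Arg2pi_unique[of 1 b "cis b"] by (simp add: cis_conv_exp)
  then show "r = s \<and> a = b" using rs by simp
qed

lemma polar_map_image: "polar_map ` polar_domain = - {0}"
proof -
  have "v \<in> polar_map ` polar_domain" if "v \<noteq> 0" for v
  proof -
    define z where "z = Complex (v $ 1) (v $ 2)"
    have "z \<noteq> 0" using that by (auto simp: z_def complex_eq_iff vec_eq_iff forall_2)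
    have "z = of_real (norm z) * exp (\<i> * of_real (Arg2pi z))"
      by (rule Arg2pi_eq)
    then have "z = of_real (norm z) * cis (Arg2pi z)" by (simp add: cis_conv_exp)
    then have "v $ 1 = norm z * cos (Arg2pi z)" "v $ 2 = norm z * sin (Arg2pi z)"
      by (simp_all add: complex_eq_iff z_def)
    then have "v = polar_map (norm z, Arg2pi z)"
      by (simp add: polar_map_def vec_eq_iff forall_2)
    moreover have "(norm z, Arg2pi z) \<in> polar_domain"
      using \<open>z \<noteq> 0\<close> Arg2pi_ge_0[of z] Arg2pi_lt_2pi[of z] by (simp add: polar_domain_def)
    ultimately show ?thesis by blast
  qed
  moreover have "polar_map p \<noteq> 0" if "p \<in> polar_domain" for p
  proof
    assume "polar_map p = 0"
    then have "fst p * cos (snd p) = 0" "fst p * sin (snd p) = 0"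
      by (auto simp: polar_map_def vec_eq_iff forall_2)
    moreover have "fst p \<noteq> 0" using that by (auto simp: polar_domain_def)
    ultimately show False
      using sin_cos_squared_add[of "snd p"] by simp
  qed
  ultimately show ?thesis by auto
qed

lemma borel_measurable_fst_real [measurable]: "(fst :: real \<times> real \<Rightarrow> real) \<in> borel_measurable borel"
  by (intro borel_measurable_continuous_onI continuous_intros)

text \<open>Polar coordinates as an identity of measures. Lebesgue measure is determined by its values on
  boxes, so it suffices to compare the two sides there. For a box, the change of variables theorem
  gives its area as the integral of the Jacobian determinant \<open>r\<close> over the parameters that are
  mapped into it; the origin, which the parametrisation misses, is a null set. An identity of
  measures serves both for integrals of complex functions and for null sets.\<close>

lemma lborel_polar:
  "distr (density lborel (\<lambda>p. ennreal (fst p) * indicator polar_domain p)) borel polar_map = lborel"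
    (is "distr ?M _ _ = _")
proof (rule lborel_eqI[symmetric])
  fix l u :: "real^2" assume lu: "\<And>b. b \<in> Basis \<Longrightarrow> l \<bullet> b \<le> u \<bullet> b"
  define G where "G v = (v$1) *\<^sub>R dir (v$2)" for v :: "real^2"
  define G' where "G' v h = (h$1) *\<^sub>R dir (v$2) + (v$1 * h$2) *\<^sub>R (vector [- sin (v$2), cos (v$2)])" for v h :: "real^2"
  define R where "R = {v :: real^2. 0 < v$1 \<and> 0 \<le> v$2 \<and> v$2 < 2*pi}"
  define S where "S = {v \<in> R. G v \<in> box l u}"
  have [measurable]: "G \<in> borel_measurable borel"
    unfolding G_def by (intro borel_measurable_continuous_onI continuous_intros)
  have [measurable]: "R \<in> sets borel" unfolding R_def by measurable
  have Sb [measurable]: "S \<in> sets borel" unfolding S_def by measurable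
  have vec: "G (vector [fst p, snd p]) = polar_map p"
      "vector [fst p, snd p] \<in> R \<longleftrightarrow> p \<in> polar_domain" for p
    by (cases p, simp add: G_def polar_map_def R_def polar_domain_def)+
  have surjv: "\<exists>p. v = vector [fst p, snd p]" for v :: "real^2"
    by (intro exI[of _ "(v$1, v$2)"]) (simp add: vec_eq_iff forall_2)
  have deriv: "(G has_derivative G' v) (at v within S)" for v
  proof -
    have "((\<lambda>v. G v $ i) has_derivative (\<lambda>h. G' v h $ i)) (at v within S)" for i
      using exhaust_2[of i]
      by (auto simp: G_def G'_def intro!: derivative_eq_intros bounded_linear_imp_has_derivative bounded_linear_vec_nth)
    then show ?thesis
      by (subst has_derivative_componentwise_within) (auto simp: Basis_vec_def inner_axis)
  qed
  have inj: "inj_on G S"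
  proof (rule inj_onI)
    fix v w assume "v \<in> S" "w \<in> S" and e: "G v = G w"
    obtain p q where pq: "v = vector [fst p, snd p]" "w = vector [fst q, snd q]"
      using surjv by metis
    then have "p \<in> polar_domain" "q \<in> polar_domain" "polar_map p = polar_map q"
      using \<open>v \<in> S\<close> \<open>w \<in> S\<close> e by (auto simp: S_def vec)
    then show "v = w" using inj_on_polar pq by (auto dest: inj_onD)
  qed
  have det: "\<bar>det (matrix (G' v))\<bar> = v$1" if "v \<in> S" for v
  proof -
    have "det (matrix (G' v)) = v$1 * (cos (v$2) * cos (v$2) + sin (v$2) * sin (v$2))"
      by (simp only: det_2) (simp add: matrix_def G'_def axis_def distrib_left mult_ac del: sin_cos_squared_add3)
    also have "\<dots> = v$1"
      using sin_cos_squared_add[of "v$2"] by (simp add: power2_eq_square)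
    finally have "det (matrix (G' v)) = v$1" .
    then show ?thesis using that by (simp add: S_def R_def)
  qed
  have img: "G ` S = box l u - {0}"
  proof -
    have "G ` S = polar_map ` polar_domain \<inter> box l u"
    proof safe
      fix v assume "v \<in> S"
      obtain p where p: "v = vector [fst p, snd p]" using surjv by metis
      with \<open>v \<in> S\<close> show "G v \<in> polar_map ` polar_domain" "G v \<in> box l u"
        by (auto simp: S_def vec)
    next
      fix p assume "p \<in> polar_domain" "polar_map p \<in> box l u"
      then show "polar_map p \<in> G ` S"
        by (intro image_eqI[of _ _ "vector [fst p, snd p]"]) (auto simp: S_def vec)
    qed
    then show ?thesis by (auto simp: polar_map_image)
  qed
  define m where "m = measure lebesgue (G ` S)"
  have "G ` S \<in> lmeasurable"
    unfolding img by (intro fmeasurable.Diff) (auto intro: lmeasurable_compact)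
  then have "((\<lambda>v. \<bar>det (matrix (G' v))\<bar>) has_integral m) S"
    using has_measure_differentiable_image[of S G G' m] deriv inj Sb by (auto simp: m_def)
  then have "((\<lambda>v. v$1) has_integral m) S"
    by (rule has_integral_eq[rotated]) (simp add: det)
  then have nn: "(\<integral>\<^sup>+v. ennreal (v$1) * indicator S v \<partial>lborel) = ennreal m"
    by (intro nn_integral_has_integral_lebesgue') (auto simp: S_def R_def)
  have "emeasure (distr ?M borel polar_map) (box l u) = emeasure ?M (polar_map -` box l u)"
    by (subst emeasure_distr) auto
  also have "\<dots> = (\<integral>\<^sup>+p. ennreal (fst p) * indicator polar_domain p * indicator (polar_map -` box l u) p \<partial>lborel)"
    by (rule emeasure_density) (auto intro!: measurable_sets_borel[OF borel_measurable_polar_map])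
  also have "\<dots> = (\<integral>\<^sup>+p. ennreal ((vector [fst p, snd p] :: real^2) $ 1) * indicator S (vector [fst p, snd p]) \<partial>lborel)"
    by (intro nn_integral_cong) (auto simp: S_def vec indicator_def)
  also have "\<dots> = (\<integral>\<^sup>+v. ennreal (v$1) * indicator S v \<partial>distr lborel borel (\<lambda>p. vector [fst p, snd p]))"
    by (subst nn_integral_distr) auto
  also have "\<dots> = ennreal m"
    by (simp add: lborel_vec2 nn)
  also have "m = measure lborel (box l u)"
    unfolding m_def img by (subst measure_Diff_null_set) auto
  also have "ennreal \<dots> = (\<Prod>b\<in>Basis. (u - l) \<bullet> b)"
    using lu by simp
  finally show "emeasure (distr ?M borel polar_map) (box l u) = (\<Prod>b\<in>Basis. (u - l) \<bullet> b)" .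
qed simp

lemma density_polar_eq:
  "(\<lambda>p. ennreal (fst p) * indicator polar_domain p) = (\<lambda>p. ennreal (indicator polar_domain p * fst p))"
  by (auto simp: fun_eq_iff indicator_def)

lemma integral_polar:
  fixes H :: "real^2 \<Rightarrow> complex"
  assumes [measurable]: "H \<in> borel_measurable borel"
  shows "(\<integral>y. H y \<partial>lborel) = (\<integral>p. (indicator polar_domain p * fst p) *\<^sub>R H (polar_map p) \<partial>lborel)"
proof -
  have "(\<integral>y. H y \<partial>lborel) =
     (\<integral>p. H (polar_map p) \<partial>density lborel (\<lambda>p. ennreal (indicator polar_domain p * fst p)))"
    by (subst lborel_polar[symmetric], subst integral_distr) (auto simp: density_polar_eq)
  also have "\<dots> = (\<integral>p. (indicator polar_domain p * fst p) *\<^sub>R H (polar_map p) \<partial>lborel)"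
    by (subst integral_density) (auto intro!: AE_I2 split: split_indicator simp: polar_domain_def[THEN eqset_imp_iff])
  finally show ?thesis .
qed

text \<open>Null sets of the plane pull back to null sets of the parameter domain since the Jacobian
  factor \<open>fst p\<close> is strictly positive there. This transports the almost-everywhere identity between
  \<open>q\<close> and its Borel representative to polar coordinates.\<close>

lemma AE_polar:
  assumes "AE y in lborel. P y"
  shows "AE p in lborel. p \<in> polar_domain \<longrightarrow> P (polar_map p)"
proof -
  have "AE y in distr (density lborel (\<lambda>p. ennreal (fst p) * indicator polar_domain p)) borel polar_map. P y"
    using assms unfolding lborel_polar .
  then have "AE p in density lborel (\<lambda>p. ennreal (fst p) * indicator polar_domain p). P (polar_map p)"
    by (rule AE_distrD[rotated]) simp
  moreover have "(\<lambda>p. ennreal (fst p) * indicator polar_domain p) \<in> borel_measurable lborel"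
    by measurable
  ultimately have "AE p in lborel. 0 < ennreal (fst p) * indicator polar_domain p \<longrightarrow> P (polar_map p)"
    by (simp add: AE_density)
  then show ?thesis
    by eventually_elim (auto simp: polar_domain_def)
qed

section \<open>Borel representatives and Fubini\<close>

text \<open>The complement of the essential support is a possibly uncountable union of open sets on each of
  which \<open>q\<close> vanishes almost everywhere. By the Lindelof property countably many of them already
  cover it, so the union of the exceptional sets is still a null set.\<close>

lemma AE_zero_off_ess_support: "AE y in lebesgue. y \<notin> ess_support q \<longrightarrow> q y = 0"
proof -
  define F where "F = {U. open U \<and> (AE y in lebesgue. y \<in> U \<longrightarrow> q y = 0)}"
  obtain F' where F': "F' \<subseteq> F" "countable F'" "\<Union>F' = \<Union>F"
    by (rule Lindelof[of F]) (auto simp: F_def)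
  have "AE y in lebesgue. \<forall>U\<in>F'. y \<in> U \<longrightarrow> q y = 0"
    using F'(1,2) by (subst AE_ball_countable) (auto simp: F_def)
  moreover have "- ess_support q = \<Union>F'"
    using F'(3) by (simp add: ess_support_def F_def)
  ultimately show ?thesis
    by (auto elim!: eventually_mono)
qed

lemma completion_ex_borel_measurable_complex:
  fixes g :: "'a \<Rightarrow> complex"
  assumes "g \<in> borel_measurable (completion M)"
  obtains g' where "g' \<in> borel_measurable M" "AE x in M. g x = g' x"
proof -
  have "(\<lambda>x. Re (g x)) \<in> borel_measurable (completion M)" "(\<lambda>x. Im (g x)) \<in> borel_measurable (completion M)"
    using assms by simp_all
  from this[THEN completion_ex_borel_measurable_real]
  obtain a b where [measurable]: "a \<in> borel_measurable M" "b \<in> borel_measurable M"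
    and ab: "AE x in M. Re (g x) = a x" "AE x in M. Im (g x) = b x"
    by blast
  from ab have "AE x in M. g x = Complex (a x) (b x)"
    by eventually_elim (simp add: complex_eq_iff)
  moreover have "(\<lambda>x. Complex (a x) (b x)) \<in> borel_measurable M"
    unfolding Complex_eq by measurable
  ultimately show ?thesis
    using that by blast
qed

text \<open>Agreement with \<open>g\<close> off a null set makes \<open>f\<close> Lebesgue measurable, because the Lebesgue measure
  is complete. This covers integrands cut off at a non-measurable set, as long as they vanish almost
  everywhere outside a measurable subset of it.\<close>

lemma integral_lebesgue_eq_lborel_AE:
  fixes f g :: "'a::euclidean_space \<Rightarrow> complex"
  assumes g [measurable]: "g \<in> borel_measurable borel" and eq: "AE x in lborel. f x = g x"
  shows "integral\<^sup>L lebesgue f = integral\<^sup>L lborel g"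
proof -
  have gl: "g \<in> borel_measurable lebesgue"
    using g by (simp add: measurable_completion)
  have eq': "AE x in lebesgue. g x = f x"
    using eq by (simp add: AE_completion_iff eq_commute)
  have "f \<in> borel_measurable lebesgue"
    using gl eq' by (rule borel_measurable_AE)
  then have "integral\<^sup>L lebesgue f = integral\<^sup>L lebesgue g"
    using eq' gl by (intro integral_cong_AE) (auto simp: eq_commute)
  then show ?thesis
    by (simp add: integral_completion)
qed

text \<open>Almost everywhere, cutting \<open>q\<close> off at the possibly non-measurable set \<open>D\<close> is the same as
  cutting it off at its compact essential support, outside of which \<open>q\<close> vanishes. Integrability
  comes from boundedness on a set of finite measure. Working with the Borel function \<open>Q\<close> is what
  makes Fubini's theorem and composition with the polar map applicable.\<close>

lemma ess_bounded_borel_representative: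
  assumes q: "ess_bounded q" and S: "compact (ess_support q)" "ess_support q \<subseteq> D"
  obtains Q where "Q \<in> borel_measurable borel" "integrable lborel Q"
    "AE y in lborel. indicator D y *\<^sub>R q y = Q y"
proof -
  obtain B where qm: "q \<in> borel_measurable lebesgue" and B: "AE y in lborel. norm (q y) \<le> B"
    using q by (auto simp: ess_bounded_def AE_completion_iff)
  obtain q' where [measurable]: "q' \<in> borel_measurable borel" and q': "AE y in lborel. q y = q' y"
    using completion_ex_borel_measurable_complex[OF qm] by auto
  have [measurable]: "ess_support q \<in> sets borel"
    using S(1) by (simp add: borel_compact)
  define Q where "Q y = (if y \<in> ess_support q \<and> norm (q' y) \<le> B then q' y else 0)" for y
  have [measurable]: "Q \<in> borel_measurable borel"
    unfolding Q_def by measurable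
  obtain a where "ess_support q \<subseteq> cbox (- a) a"
    using bounded_subset_cbox_symmetric[OF compact_imp_bounded[OF S(1)]] .
  then have "emeasure lborel (ess_support q) \<le> emeasure lborel (cbox (- a) a)"
    by (rule emeasure_mono) simp
  then have "emeasure lborel (ess_support q) < \<infinity>"
    using emeasure_lborel_cbox_finite le_less_trans by blast
  then have "integrable lborel (\<lambda>y. B * indicator (ess_support q) y)"
    by simp
  then have "integrable lborel Q"
    by (rule Bochner_Integration.integrable_bound) (auto simp: Q_def)
  moreover have "AE y in lborel. y \<notin> ess_support q \<longrightarrow> q y = 0"
    using AE_zero_off_ess_support[of q] by (simp add: AE_completion_iff)
  with q' B have "AE y in lborel. indicator D y *\<^sub>R q y = Q y"
    by eventually_elim (use S(2) in \<open>auto simp: Q_def indicator_def\<close>)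
  ultimately show ?thesis
    using that by simp
qed

text \<open>Swaps the integral over one angle with the integral over the plane. The angle runs over a
  bounded interval and \<open>F\<close> is bounded, so the integrand is dominated by \<open>norm (h y)\<close> times the
  indicator of the interval. The integrability claim allows the swap to be done twice, once for
  each angle.\<close>

lemma integral_Icc_swap:
  fixes h :: "real^2 \<Rightarrow> complex" and F :: "real \<Rightarrow> real^2 \<Rightarrow> complex"
  assumes h: "integrable lborel h"
    and F [measurable]: "(\<lambda>(y, t). F t y) \<in> borel_measurable (borel \<Otimes>\<^sub>M borel)"
    and le: "\<And>t y. norm (F t y) \<le> 1" and ab: "a \<le> b"
  shows "(LINT t:{a..b}|lebesgue. \<integral>y. h y * F t y \<partial>lborel) =
    (\<integral>y. h y * (LINT t:{a..b}|lborel. F t y) \<partial>lborel)"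
    and "integrable lborel (\<lambda>y. h y * (LINT t:{a..b}|lborel. F t y))"
proof -
  note [measurable] = borel_measurable_integrable[OF h]
  define f where "f y t = h y * (indicator {a..b} t *\<^sub>R F t y)" for y t
  have [measurable]: "(\<lambda>x. F (snd x) (fst x)) \<in> borel_measurable (borel \<Otimes>\<^sub>M borel)"
    using F by (simp add: case_prod_beta)
  have fm: "case_prod f \<in> borel_measurable (lborel \<Otimes>\<^sub>M lborel)"
    unfolding f_def case_prod_beta by measurable
  have "integrable (lborel \<Otimes>\<^sub>M lborel) (\<lambda>x. norm (h (fst x)) * indicator {a..b} (snd x))"
    using h ab by (intro lborel_pair.Fubini_integrable) auto
  then have int: "integrable (lborel \<Otimes>\<^sub>M lborel) (case_prod f)"
    by (rule Bochner_Integration.integrable_bound)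
       (use fm in \<open>auto simp: f_def norm_mult case_prod_beta le intro!: AE_I2 mult_left_le split: split_indicator\<close>)
  have inner: "(\<integral>t. f y t \<partial>lborel) = h y * (LINT t:{a..b}|lborel. F t y)" for y
    unfolding f_def set_lebesgue_integral_def by (rule integral_mult_right_zero)
  have "(LINT t:{a..b}|lebesgue. \<integral>y. h y * F t y \<partial>lborel) = (\<integral>t. (\<integral>y. f y t \<partial>lborel) \<partial>lborel)"
    unfolding set_lebesgue_integral_def f_def
    by (subst integral_completion) (auto simp: case_prod_beta)
  also have "\<dots> = (\<integral>y. (\<integral>t. f y t \<partial>lborel) \<partial>lborel)"
    using int by (rule lborel_pair.Fubini_integral)
  finally show "(LINT t:{a..b}|lebesgue. \<integral>y. h y * F t y \<partial>lborel) =
    (\<integral>y. h y * (LINT t:{a..b}|lborel. F t y) \<partial>lborel)"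
    by (simp only: inner)
  show "integrable lborel (\<lambda>y. h y * (LINT t:{a..b}|lborel. F t y))"
    using lborel_pair.integrable_fst[OF int] by (simp add: inner)
qed

section \<open>Fourier coefficients of plane waves\<close>

lemma inner_dir_polar_map: "dir t \<bullet> polar_map (r, \<psi>) = r * cos (t - \<psi>)"
  by (simp add: polar_map_def inner_vec_def sum_2 cos_diff algebra_simps)

text \<open>Up to the factor \<open>2 * pi\<close> this is the \<open>m\<close>-th Fourier coefficient, in the direction \<open>t\<close>, of a
  plane wave evaluated at \<open>y\<close>. The sign \<open>\<sigma> = - \<i>\<close> belongs to the observation direction and
  \<open>\<sigma> = \<i>\<close> to the incident direction.\<close>

definition plane_wave_coeff :: "complex \<Rightarrow> real \<Rightarrow> int \<Rightarrow> real^2 \<Rightarrow> complex" where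
  "plane_wave_coeff \<sigma> k m y =
     (LINT t:{0..2*pi}|lborel. exp (\<sigma> * of_real (k * (dir t \<bullet> y))) * cis (- (of_int m * t)))"

lemma plane_wave_coeff_polar:
  assumes "\<sigma>\<^sup>2 = -1" "k > 0" "r > 0"
  shows "plane_wave_coeff \<sigma> k m (polar_map (r, \<psi>)) =
    2 * of_real pi * \<sigma> powi m * of_real (bessel_J m (k * r)) * cis (- (of_int m * \<psi>))"
  using integral_exp_cos_coeff[where \<sigma> = \<sigma> and x = "k * r" and m = m and \<psi> = \<psi>] assms
  by (simp add: plane_wave_coeff_def inner_dir_polar_map mult.assoc)

theorem proposition2p1:
  fixes q :: "real^2 \<Rightarrow> complex" and D :: "(real^2) set"
    and k :: real and C :: complex and u :: "real \<Rightarrow> real \<Rightarrow> complex"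
  assumes "ess_bounded q"
    and "bounded D"
    and "compact (ess_support q)" and "ess_support q \<subseteq> D"
    and "k > 0" and "C \<noteq> 0"
    and "\<And>\<theta> \<phi>. u \<theta> \<phi> = born_far_field C q D k \<theta> \<phi>"
  shows "\<forall>m n :: int. two_angle_coeff u m n =
    C * (- \<i>) powi m * \<i> powi n *
      (LINT (r, \<psi>):polar_region D|lebesgue.
         q (r *\<^sub>R dir \<psi>) * of_real (bessel_J m (k * r)) * of_real (bessel_J n (k * r)) *
         exp (- \<i> * of_int (m + n) * of_real \<psi>) * of_real r)"
proof (intro allI)
  fix m n :: int
  obtain Q where [measurable]: "Q \<in> borel_measurable borel" and Qi: "integrable lborel Q"
    and Q: "AE y in lborel. indicator D y *\<^sub>R q y = Q y"
    using ess_bounded_borel_representative assms(1,3,4) by blast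
  define F where "F t y = exp (- \<i> * of_real (k * (dir t \<bullet> y))) * cis (- (of_int m * t))" for t :: real and y
  define G where "G t y = exp (\<i> * of_real (k * (dir t \<bullet> y))) * cis (- (of_int n * t))" for t :: real and y
  have Fm [measurable]: "(\<lambda>(y, t). F t y) \<in> borel_measurable (borel \<Otimes>\<^sub>M borel)"
    unfolding F_def by measurable
  have Gm [measurable]: "(\<lambda>(y, t). G t y) \<in> borel_measurable (borel \<Otimes>\<^sub>M borel)"
    unfolding G_def by measurable
  have nF: "norm (F t y) = 1" and nG: "norm (G t y) = 1" for t y
    by (simp_all add: F_def G_def norm_mult)
  define A where "A = plane_wave_coeff (- \<i>) k m"
  define B where "B = plane_wave_coeff \<i> k n"
  have A: "A y = (LINT t:{0..2*pi}|lborel. F t y)" and B: "B y = (LINT t:{0..2*pi}|lborel. G t y)" for y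
    by (simp_all add: A_def B_def F_def G_def plane_wave_coeff_def)
  \<comment> \<open>The plane wave for the direction difference factors into one wave per angle, so the twisted
    far field is an integral of \<open>Q\<close> against a product that separates the angles.\<close>
  have u: "u \<theta> \<phi> * exp (- \<i> * of_int m * of_real \<theta>) * exp (- \<i> * of_int n * of_real \<phi>) =
     C * (\<integral>y. (Q y * G \<phi> y) * F \<theta> y \<partial>lborel)" for \<theta> \<phi>
  proof -
    define E where "E y = exp (- \<i> * of_real (k * ((dir \<theta> - dir \<phi>) \<bullet> y)))" for y
    have [measurable]: "E \<in> borel_measurable borel"
      unfolding E_def by measurable
    have "u \<theta> \<phi> = C * (\<integral>y. Q y * E y \<partial>lborel)"
      unfolding assms(7) born_far_field_def set_lebesgue_integral_def E_def[symmetric]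
      by (subst integral_lebesgue_eq_lborel_AE[where g = "\<lambda>y. Q y * E y"])
         (use Q in \<open>auto elim!: eventually_mono simp flip: mult_scaleR_left\<close>)
    moreover have "exp (- \<i> * of_int m * of_real \<theta>) = cis (- (of_int m * \<theta>))"
        "exp (- \<i> * of_int n * of_real \<phi>) = cis (- (of_int n * \<phi>))"
      by (simp_all add: cis_conv_exp mult.assoc)
    moreover have "(\<integral>y. (Q y * G \<phi> y) * F \<theta> y \<partial>lborel) =
        (\<integral>y. Q y * E y \<partial>lborel) * (cis (- (of_int m * \<theta>)) * cis (- (of_int n * \<phi>)))"
    proof -
      have "(Q y * G \<phi> y) * F \<theta> y = Q y * E y * (cis (- (of_int m * \<theta>)) * cis (- (of_int n * \<phi>)))" for y
      proof -
        have "E y = exp (- \<i> * of_real (k * (dir \<theta> \<bullet> y))) * exp (\<i> * of_real (k * (dir \<phi> \<bullet> y)))"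
          unfolding E_def exp_add[symmetric] by (simp add: inner_diff_left algebra_simps)
        then show ?thesis by (simp add: F_def G_def)
      qed
      then show ?thesis
        by (simp only: integral_mult_left_zero)
    qed
    ultimately show ?thesis by simp
  qed
  have QG: "integrable lborel (\<lambda>y. Q y * G \<phi> y)" for \<phi>
    by (rule Bochner_Integration.integrable_bound[OF Qi]) (auto simp: norm_mult nG)
  have inner: "(LINT \<theta>:{0..2*pi}|lebesgue. \<integral>y. (Q y * G \<phi> y) * F \<theta> y \<partial>lborel) =
      (\<integral>y. (Q y * A y) * G \<phi> y \<partial>lborel)" for \<phi>
    using integral_Icc_swap(1)[OF QG Fm, of 0 "2*pi" \<phi>] nF by (simp add: A mult_ac)
  have QA: "integrable lborel (\<lambda>y. Q y * A y)"
    using integral_Icc_swap(2)[OF Qi Fm, of 0 "2*pi"] nF by (simp add: A)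
  have QAB: "integrable lborel (\<lambda>y. Q y * A y * B y)"
    using integral_Icc_swap(2)[OF QA Gm, of 0 "2*pi"] nG by (simp add: B)
  note [measurable] = borel_measurable_integrable[OF QAB]
  have outer: "(LINT \<phi>:{0..2*pi}|lebesgue. \<integral>y. (Q y * A y) * G \<phi> y \<partial>lborel) =
      (\<integral>y. Q y * A y * B y \<partial>lborel)"
    using integral_Icc_swap(1)[OF QA Gm, of 0 "2*pi"] nG by (simp add: B)
  have coeff: "two_angle_coeff u m n = 1 / (2 * of_real pi)\<^sup>2 * (C * (\<integral>y. Q y * A y * B y \<partial>lborel))"
    unfolding two_angle_coeff_def u by (simp add: inner outer)
  \<comment> \<open>It remains to compare with the integral on the right-hand side in polar coordinates; \<open>c\<close>
    collects the constants produced by the two plane wave coefficients.\<close>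
  define f where "f = (\<lambda>(r, \<psi>). q (r *\<^sub>R dir \<psi>) * of_real (bessel_J m (k * r)) * of_real (bessel_J n (k * r)) *
         exp (- \<i> * of_int (m + n) * of_real \<psi>) * of_real r)"
  define c where "c = (2 * of_real pi)\<^sup>2 * ((- \<i>) powi m * \<i> powi n)"
  have "c \<noteq> 0" by (simp add: c_def)
  define g where "g p = (indicator polar_domain p * fst p) *\<^sub>R (Q (polar_map p) * A (polar_map p) * B (polar_map p))" for p
  have "AE p in lborel. indicator (polar_region D) p *\<^sub>R f p = g p / c"
    using AE_polar[OF Q]
  proof eventually_elim
    case (elim p)
    obtain r \<psi> where p: "p = (r, \<psi>)" by (cases p)
    show ?case
    proof (cases "p \<in> polar_domain")
      case True
      then have r: "r > 0" and reg: "p \<in> polar_region D \<longleftrightarrow> polar_map p \<in> D"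
        by (auto simp: p polar_domain_def polar_region_def polar_map_def)
      have "exp (- \<i> * of_int (m + n) * of_real \<psi>) = cis (- (of_int m * \<psi>)) * cis (- (of_int n * \<psi>))"
        by (simp add: cis_conv_exp exp_add[symmetric] algebra_simps)
      moreover have "indicator (polar_region D) p *\<^sub>R q (r *\<^sub>R dir \<psi>) = Q (polar_map p)"
        using elim True reg by (simp add: indicator_def p polar_map_def)
      moreover have "A (polar_map p) = 2 * of_real pi * (- \<i>) powi m * of_real (bessel_J m (k * r)) * cis (- (of_int m * \<psi>))"
          "B (polar_map p) = 2 * of_real pi * \<i> powi n * of_real (bessel_J n (k * r)) * cis (- (of_int n * \<psi>))"
        using r assms(5) by (simp_all add: A_def B_def p plane_wave_coeff_polar)
      ultimately have "g p = c * (indicator (polar_region D) p *\<^sub>R q (r *\<^sub>R dir \<psi>) *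
          of_real (bessel_J m (k * r)) * of_real (bessel_J n (k * r)) *
          exp (- \<i> * of_int (m + n) * of_real \<psi>) * of_real r)"
        using True by (simp add: g_def c_def p scaleR_conv_of_real power2_eq_square mult_ac)
      also have "\<dots> = c * (indicator (polar_region D) p *\<^sub>R f p)"
        by (simp add: f_def p)
      finally show ?thesis
        using \<open>c \<noteq> 0\<close> by (simp add: scaleR_conv_of_real)
    next
      \<comment> \<open>The only points of the polar region outside the parameter domain have \<open>r = 0\<close>, where the
        factor \<open>r\<close> annihilates the integrand.\<close>
      case False
      then have "p \<notin> polar_region D \<or> r = 0"
        by (auto simp: p polar_domain_def polar_region_def)
      then show ?thesis
        using False by (auto simp: g_def f_def p)
    qed
  qed
  then have "(LINT p:polar_region D|lebesgue. f p) = (\<integral>p. g p / c \<partial>lborel)"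
    unfolding set_lebesgue_integral_def
    by (intro integral_lebesgue_eq_lborel_AE) (auto simp: g_def)
  also have "\<dots> = (\<integral>y. Q y * A y * B y \<partial>lborel) / c"
    unfolding g_def by (subst integral_polar) auto
  finally have "(LINT p:polar_region D|lebesgue. f p) = (\<integral>y. Q y * A y * B y \<partial>lborel) / c" .
  then have "two_angle_coeff u m n = C * (- \<i>) powi m * \<i> powi n * (LINT p:polar_region D|lebesgue. f p)"
    unfolding coeff using \<open>c \<noteq> 0\<close> by (simp add: c_def)
  then show "two_angle_coeff u m n =
    C * (- \<i>) powi m * \<i> powi n *
      (LINT (r, \<psi>):polar_region D|lebesgue.
         q (r *\<^sub>R dir \<psi>) * of_real (bessel_J m (k * r)) * of_real (bessel_J n (k * r)) *
         exp (- \<i> * of_int (m + n) * of_real \<psi>) * of_real r)"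
    by (simp only: f_def)
qed

end
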